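(* Let $V$ be a finite set, and let $F\subseteq 2^V\setminus\{\emptyset,V\}$ be a crossing family. Then $F$ admits a $\cap\cup$-closed cosigning if and only if both of the following hold: (i) for all $Z,T\in F$ with $Z\cap T\neq\emptyset$, there is an element $u\in Z\cap T$ such that $V\setminus\{u\}\neq B\cup W$ for all $B,W\in F$; and (ii) for all $X,Y\in F$ with $X\cup Y\neq V$, there is an element $v\in V\setminus(X\cup Y)$ such that $\{v\}\neq H\cap G$ for all $G,H\in F$.
   Context: A family $F$ of subsets of $V$ is a crossing family if $U\cap W\in F$ and $U\cup W\in F$ for all $U,W\in F$ with $U\cap W\neq\emptyset$ and $U\cup W\neq V$. A $\cap\cup$-closed cosigning of a family $F\subseteq 2^V\setminus\{\emptyset,V\}$ is a function $\sigma:V\to\{+,-\}$ such that for all $X,Y\in F$ with $X\cap Y\neq\emptyset$ the set $X\cap Y$ contains an element with sign $+$, and for all $X,Y\in F$ with $X\cup Y\neq V$ the set $V\setminus(X\cup Y)$ contains an element with sign $-$. Throughout, pairs of sets from $F$ are allowed to be equal. *)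

theory Defs
  imports Main
begin

definition crossing_family :: "'a set \<Rightarrow> 'a set set \<Rightarrow> bool" where
  "crossing_family V F \<longleftrightarrow>
     F \<subseteq> Pow V \<and>
     (\<forall>U\<in>F. \<forall>W\<in>F. U \<inter> W \<noteq> {} \<and> U \<union> W \<noteq> V \<longrightarrow> U \<inter> W \<in> F \<and> U \<union> W \<in> F)"

datatype sign = Positive | Negative

text \<open>A signing of \<open>V\<close> is represented by a total function on the element type; its values
  outside \<open>V\<close> play no role, since every sign condition concerns elements of \<open>V\<close> when
  \<open>F\<close> is a family of subsets of \<open>V\<close>. The sets \<open>X\<close> and \<open>Y\<close> may be equal.\<close>

definition cap_cup_closed_cosigning :: "'a set \<Rightarrow> 'a set set \<Rightarrow> ('a \<Rightarrow> sign) \<Rightarrow> bool" where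
  "cap_cup_closed_cosigning V F \<sigma> \<longleftrightarrow>
     (\<forall>X\<in>F. \<forall>Y\<in>F. X \<inter> Y \<noteq> {} \<longrightarrow> (\<exists>u \<in> X \<inter> Y. \<sigma> u = Positive)) \<and>
     (\<forall>X\<in>F. \<forall>Y\<in>F. X \<union> Y \<noteq> V \<longrightarrow> (\<exists>v \<in> V - (X \<union> Y). \<sigma> v = Negative))"

end

theory Submission
  imports Defs
begin

text \<open>
  A cosigning is a set \<open>P\<close> of positive elements that meets every set of the family \<open>A\<close> of nonempty
  intersections \<open>Z \<inter> T\<close> and includes no set of the family \<open>C\<close> of nonempty complements
  \<open>V - (X \<union> Y)\<close>. If \<open>{u} \<in> C\<close> then \<open>u\<close> is forced to be negative, and if \<open>{v} \<in> A\<close> then \<open>v\<close> is forced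
  to be positive. Conditions (i) and (ii) say that no set in \<open>A\<close> consists of forced negatives and no
  set in \<open>C\<close> of forced positives, so they are necessary.

  For sufficiency, take for \<open>P\<close> an inclusion-minimal set that avoids the forced negatives and meets
  every set in \<open>A\<close>. If \<open>P\<close> included a set of \<open>C\<close>, take a minimal such \<open>c\<close>. By (ii) it contains some
  \<open>r\<close> that is not forced to be positive, and minimality of \<open>P\<close> gives \<open>a \<in> A\<close> with \<open>a \<inter> P = {r}\<close>, so
  \<open>a \<inter> c = {r}\<close>. Uncrossing the (up to four) sets of \<open>F\<close> behind \<open>a\<close> and \<open>c\<close> (lemma
  \<open>crossing_exchange\<close>) yields either a member of \<open>A\<close> within \<open>a - {r}\<close>, which \<open>P\<close> misses, or a
  member of \<open>C\<close> within \<open>c - {r}\<close>, against minimality of \<open>c\<close>. Lemma \<open>exchange_transversal\<close> derives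
  \<open>P\<close> from this exchange property for arbitrary set families \<open>A\<close> and \<open>C\<close>.
\<close>

text \<open>
  The two minimal choices described above. That \<open>P\<close> contains every \<open>v\<close> with \<open>{v} \<in> A\<close> is automatic
  for a set that meets all of \<open>A\<close>; only avoiding the \<open>u\<close> with \<open>{u} \<in> C\<close> has to be imposed.
\<close>

lemma exchange_transversal:
  fixes V :: "'a set" and A C :: "'a set set"
  assumes "finite V" and "A \<subseteq> Pow V" and "C \<subseteq> Pow V"
    and A_free: "\<And>a. a \<in> A \<Longrightarrow> \<exists>u\<in>a. {u} \<notin> C"
    and C_free: "\<And>c. c \<in> C \<Longrightarrow> \<exists>v\<in>c. {v} \<notin> A"
    and exchange: "\<And>a c r. \<lbrakk>a \<in> A; c \<in> C; a \<inter> c = {r}; a \<noteq> {r}; c \<noteq> {r}\<rbrakk> \<Longrightarrow>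
        (\<exists>a'\<in>A. a' \<subseteq> a - {r}) \<or> (\<exists>c'\<in>C. c' \<subseteq> c - {r})"
  shows "\<exists>P. (\<forall>a\<in>A. a \<inter> P \<noteq> {}) \<and> (\<forall>c\<in>C. \<not> c \<subseteq> P)"
proof -
  define \<P> where "\<P> = {P. P \<subseteq> {v \<in> V. {v} \<notin> C} \<and> (\<forall>a\<in>A. a \<inter> P \<noteq> {})}"
  have "{v \<in> V. {v} \<notin> C} \<in> \<P>"
    unfolding \<P>_def using A_free assms(2) by fastforce
  moreover have "finite \<P>"
    by (rule finite_subset[of _ "Pow V"]) (use assms(1) in \<open>auto simp: \<P>_def\<close>)
  ultimately obtain P where "P \<in> \<P>" and P_min: "\<And>Q. Q \<in> \<P> \<Longrightarrow> Q \<subseteq> P \<Longrightarrow> P = Q"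
    using finite_has_minimal[of \<P>] by blast
  then have P: "P \<subseteq> V" "\<And>v. v \<in> P \<Longrightarrow> {v} \<notin> C" "\<And>a. a \<in> A \<Longrightarrow> a \<inter> P \<noteq> {}"
    unfolding \<P>_def by blast+
  have "\<not> c \<subseteq> P" if "c \<in> C" for c
  proof
    assume "c \<subseteq> P"
    define \<C> where "\<C> = {c \<in> C. c \<subseteq> P}"
    have "finite \<C>"
      by (rule finite_subset[of _ "Pow V"]) (use assms(1,3) in \<open>auto simp: \<C>_def\<close>)
    moreover have "\<C> \<noteq> {}"
      unfolding \<C>_def using that \<open>c \<subseteq> P\<close> by blast
    ultimately obtain c where "c \<in> \<C>" and c_min: "\<And>d. d \<in> \<C> \<Longrightarrow> d \<subseteq> c \<Longrightarrow> c = d"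
      using finite_has_minimal[of \<C>] by blast
    then have c: "c \<in> C" "c \<subseteq> P"
      unfolding \<C>_def by blast+
    obtain r where r: "r \<in> c" "{r} \<notin> A"
      using C_free c(1) by blast
    then have "r \<in> P" "{r} \<notin> C"
      using c(2) P(2) by blast+
    have "P - {r} \<notin> \<P>"
      using P_min[of "P - {r}"] \<open>r \<in> P\<close> by blast
    then obtain a where a: "a \<in> A" "a \<inter> (P - {r}) = {}"
      unfolding \<P>_def using P(1,2) by blast
    then have "a \<inter> P = {r}"
      using P(3)[OF a(1)] by blast
    then have "a \<inter> c = {r}"
      using r(1) c(2) by blast
    from exchange[OF a(1) c(1) this]
    consider a' where "a' \<in> A" "a' \<subseteq> a - {r}" | c' where "c' \<in> C" "c' \<subseteq> c - {r}"
      using a(1) c(1) r(2) \<open>{r} \<notin> C\<close> by blast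
    then show False
    proof cases
      case 1
      then show False using P(3)[of a'] a(2) by blast
    next
      case 2
      then have "c' \<in> \<C>"
        unfolding \<C>_def using c(2) by blast
      then show False using c_min[of c'] 2(2) r(1) by blast
    qed
  qed
  with P(3) show ?thesis by blast
qed

lemma crossing_familyD:
  assumes "crossing_family V F" "U \<in> F" "W \<in> F" "U \<inter> W \<noteq> {}" "U \<union> W \<noteq> V"
  shows "U \<inter> W \<in> F" "U \<union> W \<in> F"
  using assms unfolding crossing_family_def by blast+

text \<open>
  The point \<open>r\<close> is the only one in \<open>(Z \<inter> T) - (X \<union> Y)\<close>, and one of \<open>X\<close>, \<open>Y\<close> meets \<open>Z \<inter> T\<close>; by
  symmetry let it be \<open>X\<close>. If \<open>X\<close> crosses both \<open>Z\<close> and \<open>T\<close>, then intersecting them with \<open>X\<close> shrinks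
  \<open>Z \<inter> T\<close> to \<open>Z \<inter> T \<inter> X\<close>, which is nonempty and avoids \<open>r\<close>. Otherwise say \<open>Z \<union> X = V\<close>. Then
  \<open>V - (X \<union> Y)\<close> lies in \<open>Z\<close>, so any of its points other than \<open>r\<close> lies outside \<open>T\<close>. Hence \<open>X\<close>
  crosses \<open>T\<close>, and enlarging \<open>X\<close> to \<open>X \<union> T\<close> absorbs \<open>r\<close>, while \<open>X \<union> T \<union> Y\<close>
  still misses those other points.
\<close>

lemma crossing_exchange:
  assumes cf: "crossing_family V F"
    and F: "X \<in> F" "Y \<in> F" "Z \<in> F" "T \<in> F"
    and r: "Z \<inter> T - (X \<union> Y) = {r}"
    and nontriv: "Z \<inter> T \<noteq> {r}" "V - (X \<union> Y) \<noteq> {r}"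
  shows "(\<exists>Z'\<in>F. \<exists>T'\<in>F. Z' \<inter> T' \<noteq> {} \<and> Z' \<inter> T' \<subseteq> Z \<inter> T - {r}) \<or>
    (\<exists>X'\<in>F. \<exists>Y'\<in>F. V - (X' \<union> Y') \<noteq> {} \<and> V - (X' \<union> Y') \<subseteq> V - (X \<union> Y) - {r})"
    (is "?shrink \<or> ?grow")
proof -
  have sub: "X \<subseteq> V" "Y \<subseteq> V" "Z \<subseteq> V" "T \<subseteq> V"
    using cf F unfolding crossing_family_def by blast+
  \<comment> \<open>\<open>H\<close> is the one of \<open>X\<close>, \<open>Y\<close> that meets \<open>Z \<inter> T\<close>, and \<open>G\<close> is the other one.\<close>
  have step: "?shrink \<or> ?grow"
    if H: "H \<in> F" "G \<in> F" "H \<union> G = X \<union> Y" and meet: "Z \<inter> T \<inter> H \<noteq> {}" for H G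
  proof -
    have grow: ?grow if K: "K \<in> F" "L \<in> F" "K \<inter> L = Z \<inter> T" "K \<union> H = V" for K L
    proof -
      obtain s where s: "s \<in> V" "s \<notin> H \<union> G" "s \<noteq> r"
        using nontriv(2) r sub H(3) by blast
      then have "s \<notin> L"
        using K r H(3) by blast
      then have "H \<union> L \<in> F"
        using crossing_familyD(2)[OF cf H(1) K(2)] meet K(3) s by blast
      moreover have "V - ((H \<union> L) \<union> G) \<noteq> {}"
        using s \<open>s \<notin> L\<close> by blast
      moreover have "V - ((H \<union> L) \<union> G) \<subseteq> V - (X \<union> Y) - {r}"
        using K(3) r H(3) by blast
      ultimately show ?grow
        using H(2) by meson
    qed
    show ?thesis
    proof (cases "Z \<union> H = V \<or> T \<union> H = V")
      case True
      then show ?thesis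
        using grow[of Z T] grow[of T Z] F by blast
    next
      case False
      then have "Z \<inter> H \<in> F" "T \<inter> H \<in> F"
        using crossing_familyD(1)[OF cf _ H(1)] F meet by blast+
      moreover have "(Z \<inter> H) \<inter> (T \<inter> H) \<noteq> {}"
        using meet by blast
      moreover have "(Z \<inter> H) \<inter> (T \<inter> H) \<subseteq> Z \<inter> T - {r}"
        using r H(3) by blast
      ultimately show ?thesis by meson
    qed
  qed
  have "Z \<inter> T \<inter> X \<noteq> {} \<or> Z \<inter> T \<inter> Y \<noteq> {}"
    using r nontriv(1) by blast
  then show ?thesis
  proof
    assume "Z \<inter> T \<inter> X \<noteq> {}"
    then show ?thesis by (rule step[OF F(1,2) refl])
  next
    assume "Z \<inter> T \<inter> Y \<noteq> {}"
    then show ?thesis by (rule step[OF F(2,1) Un_commute])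
  qed
qed

theorem theorem1p2:
  fixes V :: "'a set" and F :: "'a set set"
  assumes "finite V"
    and "F \<subseteq> Pow V - {{}, V}"
    and "crossing_family V F"
  shows "(\<exists>\<sigma>. cap_cup_closed_cosigning V F \<sigma>) \<longleftrightarrow>
    (\<forall>Z\<in>F. \<forall>T\<in>F. Z \<inter> T \<noteq> {} \<longrightarrow>
       (\<exists>u \<in> Z \<inter> T. \<forall>B\<in>F. \<forall>W\<in>F. V - {u} \<noteq> B \<union> W)) \<and>
    (\<forall>X\<in>F. \<forall>Y\<in>F. X \<union> Y \<noteq> V \<longrightarrow>
       (\<exists>v \<in> V - (X \<union> Y). \<forall>G\<in>F. \<forall>H\<in>F. {v} \<noteq> H \<inter> G))"
    (is "?cosigned \<longleftrightarrow> ?i \<and> ?ii")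
proof
  have sub: "X \<subseteq> V" if "X \<in> F" for X
    using assms(2) that by blast
  show "?i \<and> ?ii" if cosigned: ?cosigned
  proof -
    obtain \<sigma> where \<sigma>: "cap_cup_closed_cosigning V F \<sigma>"
      using cosigned by (rule exE)
    have pos: "\<lbrakk>X \<in> F; Y \<in> F; X \<inter> Y \<noteq> {}\<rbrakk> \<Longrightarrow> \<exists>u \<in> X \<inter> Y. \<sigma> u = Positive"
      and neg: "\<lbrakk>X \<in> F; Y \<in> F; X \<union> Y \<noteq> V\<rbrakk> \<Longrightarrow> \<exists>v \<in> V - (X \<union> Y). \<sigma> v = Negative"
      for X Y
      using \<sigma> unfolding cap_cup_closed_cosigning_def by simp_all
    have forced_neg: "V - {u} \<noteq> B \<union> W" if "u \<in> V" "\<sigma> u = Positive" "B \<in> F" "W \<in> F" for u B W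
    proof
      assume eq: "V - {u} = B \<union> W"
      then have "B \<union> W \<noteq> V" and "V - (B \<union> W) = {u}"
        using that(1) by blast+
      then show False
        using neg[OF that(3,4)] that(2) by auto
    qed
    have forced_pos: "{v} \<noteq> H \<inter> G" if "\<sigma> v = Negative" "H \<in> F" "G \<in> F" for v H G
    proof
      assume "{v} = H \<inter> G"
      then have "H \<inter> G = {v}" ..
      then show False
        using pos[OF that(2,3)] that(1) by simp
    qed
    have ?i
      using pos forced_neg sub by (meson IntD1 subsetD)
    moreover have ?ii
      using neg forced_pos by meson
    ultimately show ?thesis ..
  qed
  show ?cosigned if conds: "?i \<and> ?ii"
  proof -
    define A where "A = {Z \<inter> T |Z T. Z \<in> F \<and> T \<in> F \<and> Z \<inter> T \<noteq> {}}"
    define C where "C = {V - (X \<union> Y) |X Y. X \<in> F \<and> Y \<in> F \<and> V - (X \<union> Y) \<noteq> {}}"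
    have A_I: "Z \<inter> T \<in> A" if "Z \<in> F" "T \<in> F" "Z \<inter> T \<noteq> {}" for Z T
      unfolding A_def using that by blast
    have C_I: "V - (X \<union> Y) \<in> C" if "X \<in> F" "Y \<in> F" "V - (X \<union> Y) \<noteq> {}" for X Y
      unfolding C_def using that by blast
    have "\<exists>P. (\<forall>a\<in>A. a \<inter> P \<noteq> {}) \<and> (\<forall>c\<in>C. \<not> c \<subseteq> P)"
    proof (rule exchange_transversal[OF assms(1)])
      show "A \<subseteq> Pow V" "C \<subseteq> Pow V"
        unfolding A_def C_def using sub by blast+
    next
      fix a assume "a \<in> A"
      then obtain Z T where a: "a = Z \<inter> T" "Z \<in> F" "T \<in> F" "Z \<inter> T \<noteq> {}"
        unfolding A_def by blast
      then obtain u where u: "u \<in> a" "\<And>B W. B \<in> F \<Longrightarrow> W \<in> F \<Longrightarrow> V - {u} \<noteq> B \<union> W"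
        using conds by meson
      have "{u} \<notin> C"
      proof
        assume "{u} \<in> C"
        then obtain B W where BW: "{u} = V - (B \<union> W)" "B \<in> F" "W \<in> F"
          unfolding C_def by blast
        then have "V - {u} = B \<union> W"
          using sub[OF BW(2)] sub[OF BW(3)] by blast
        then show False
          using u(2) BW by blast
      qed
      with u(1) show "\<exists>u\<in>a. {u} \<notin> C" by blast
    next
      fix c assume "c \<in> C"
      then obtain X Y where c: "c = V - (X \<union> Y)" "X \<in> F" "Y \<in> F" "X \<union> Y \<noteq> V"
        unfolding C_def by blast
      then obtain v where "v \<in> c" "\<And>G H. G \<in> F \<Longrightarrow> H \<in> F \<Longrightarrow> {v} \<noteq> H \<inter> G"
        using conds by meson
      then show "\<exists>v\<in>c. {v} \<notin> A"
        unfolding A_def by blast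
    next
      fix a c r
      assume "a \<in> A" "c \<in> C" and r: "a \<inter> c = {r}" "a \<noteq> {r}" "c \<noteq> {r}"
      then obtain Z T X Y where
        a: "a = Z \<inter> T" "Z \<in> F" "T \<in> F" and c: "c = V - (X \<union> Y)" "X \<in> F" "Y \<in> F"
        unfolding A_def C_def by blast
      have "Z \<inter> T - (X \<union> Y) = {r}"
        using r(1) sub[OF a(2)] unfolding a(1) c(1) by blast
      from crossing_exchange[OF assms(3) c(2,3) a(2,3) this r(2,3)[unfolded a(1) c(1)]]
      show "(\<exists>a'\<in>A. a' \<subseteq> a - {r}) \<or> (\<exists>c'\<in>C. c' \<subseteq> c - {r})"
        unfolding a(1) c(1) using A_I C_I by meson
    qed
    then obtain P where "(\<forall>a\<in>A. a \<inter> P \<noteq> {}) \<and> (\<forall>c\<in>C. \<not> c \<subseteq> P)" ..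
    then have P: "a \<in> A \<Longrightarrow> a \<inter> P \<noteq> {}" "c \<in> C \<Longrightarrow> \<not> c \<subseteq> P" for a c
      by simp_all
    let ?\<sigma> = "\<lambda>v. if v \<in> P then Positive else Negative"
    have "\<exists>u \<in> X \<inter> Y. ?\<sigma> u = Positive" if "X \<in> F" "Y \<in> F" "X \<inter> Y \<noteq> {}" for X Y
      using P(1)[OF A_I[OF that]] by auto
    moreover have "\<exists>v \<in> V - (X \<union> Y). ?\<sigma> v = Negative" if "X \<in> F" "Y \<in> F" "X \<union> Y \<noteq> V" for X Y
    proof -
      have "V - (X \<union> Y) \<noteq> {}"
        using that(3) sub[OF that(1)] sub[OF that(2)] by blast
      from P(2)[OF C_I[OF that(1,2) this]] show ?thesis by auto
    qed
    ultimately have "cap_cup_closed_cosigning V F ?\<sigma>"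
      unfolding cap_cup_closed_cosigning_def by blast
    then show ?cosigned by blast
  qed
qed

end
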